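(* Let $K\ge 1$ and let $C_t\subset\mathbb{R}^K$ be the ordinal cone. The closure $C_t\cup\{0\}$ of the ordinal cone is a polyhedral cone. In particular, $C_t\cup\{0\}=\operatorname{hcone}(A)$, where $A=(a_{ij})_{i,j=1,\dots,K}\in\mathbb{R}^{K\times K}$ is given by $a_{ij}=1$ if $i\le j$ and $a_{ij}=0$ otherwise.
   Context: For $u,v\in\mathbb{R}^K$, $u$ tail-dominates $v$, written $u\leqslant_t v$, if $\sum_{i=j}^K u_i\le\sum_{i=j}^K v_i$ for all $j=1,\dots,K$ and $u\neq v$. The ordinal cone is $C_t=\{v-u\in\mathbb{R}^K: u\leqslant_t v\}$. A cone in $\mathbb{R}^K$ is a subset $C$ with $\lambda u\in C$ for all $u\in C$ and all real $\lambda>0$. For a matrix $M\in\mathbb{R}^{m\times K}$, $\operatorname{hcone}(M)=\{y\in\mathbb{R}^K: My\geqq 0\}$, where $\geqq$ is meant componentwise. A cone $C\subseteq\mathbb{R}^K$ is polyhedral if $C=\operatorname{hcone}(M)$ for some nonzero matrix $M\in\mathbb{R}^{m\times K}$. *)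

theory Defs
  imports "HOL-Analysis.Abstract_Metric_Spaces" "HOL-Analysis.L2_Norm" "Jordan_Normal_Form.Matrix"
begin

(* R^K is carrier_vec K. Indices of vectors and matrices start at 0, so the index range
   1, ..., K becomes 0, ..., K - 1. *)

definition tail_dominates :: "nat \<Rightarrow> real vec \<Rightarrow> real vec \<Rightarrow> bool" where
  "tail_dominates K u v \<longleftrightarrow>
     (\<forall>j<K. (\<Sum>i=j..<K. vec_index u i) \<le> (\<Sum>i=j..<K. vec_index v i)) \<and> u \<noteq> v"

definition ordinal_cone :: "nat \<Rightarrow> real vec set" where
  "ordinal_cone K =
     {v - u | u v. u \<in> carrier_vec K \<and> v \<in> carrier_vec K \<and> tail_dominates K u v}"

(* Only strictly positive scalars: a cone need not contain the origin. *)
definition is_cone :: "nat \<Rightarrow> real vec set \<Rightarrow> bool" where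
  "is_cone K C \<longleftrightarrow> C \<subseteq> carrier_vec K \<and> (\<forall>u\<in>C. \<forall>c>0. c \<cdot>\<^sub>v u \<in> C)"

(* The order on vectors is componentwise. *)
definition hcone :: "real mat \<Rightarrow> real vec set" where
  "hcone M = {y \<in> carrier_vec (dim_col M). 0\<^sub>v (dim_row M) \<le> M *\<^sub>v y}"

definition polyhedral_cone :: "nat \<Rightarrow> real vec set \<Rightarrow> bool" where
  "polyhedral_cone K C \<longleftrightarrow>
     is_cone K C \<and> (\<exists>m. \<exists>M\<in>carrier_mat m K. M \<noteq> 0\<^sub>m m K \<and> C = hcone M)"

(* The type of vectors carries no topology; this is the one of the Euclidean distance. *)
definition euclidean_topology :: "nat \<Rightarrow> real vec topology" where
  "euclidean_topology K =
     Metric_space.mtopology (carrier_vec K)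
       (\<lambda>x y. L2_set (\<lambda>i. vec_index x i - vec_index y i) {..<K})"

end

theory Submission
  imports Defs
begin

text \<open>
  Adjoining the origin removes the condition \<open>u \<noteq> v\<close> from tail domination, so that
  \<open>C\<^sub>t \<union> {0}\<close> is the set of vectors all of whose tail sums are nonnegative
  (\<open>ordinal_cone_Un_zero_iff\<close>). The tail sums of \<open>y\<close> are the entries of \<open>A y\<close>, because row \<open>i\<close>
  of the upper triangular matrix \<open>A\<close> selects the coordinates from \<open>i\<close> on; this gives the
  description as \<open>hcone A\<close> and, since tail sums are homogeneous, the cone property.

  For the closure, two estimates suffice. Moving a point by less than \<open>r\<close> changes each tail sum
  by at most \<open>K r\<close>, so nonnegativity of tail sums survives in the limit. The origin is
  itself a limit of the vectors \<open>c e\<^sub>0\<close> with \<open>c > 0\<close>, which lie in \<open>C\<^sub>t\<close>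
  because \<open>K \<ge> 1\<close>.
\<close>

lemma Metric_space_carrier_vec:
  "Metric_space (carrier_vec K)
     (\<lambda>x y. L2_set (\<lambda>i. vec_index x i - vec_index y i) {..<K})"
proof
  fix x y :: "real vec"
  show "0 \<le> L2_set (\<lambda>i. x $ i - y $ i) {..<K}"
    by (rule L2_set_nonneg)
  show "L2_set (\<lambda>i. x $ i - y $ i) {..<K} = L2_set (\<lambda>i. y $ i - x $ i) {..<K}"
    by (simp add: L2_set_def power2_commute)
  assume "x \<in> carrier_vec K" "y \<in> carrier_vec K"
  then show "(L2_set (\<lambda>i. x $ i - y $ i) {..<K} = 0) = (x = y)"
    by (auto simp: L2_set_eq_0_iff)
next
  fix x y z :: "real vec"
  show "L2_set (\<lambda>i. x $ i - z $ i) {..<K}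
      \<le> L2_set (\<lambda>i. x $ i - y $ i) {..<K} + L2_set (\<lambda>i. y $ i - z $ i) {..<K}"
    using L2_set_triangle_ineq[of "\<lambda>i. x $ i - y $ i" "\<lambda>i. y $ i - z $ i" "{..<K}"] by simp
qed

lemma in_closure_of_euclidean_iff:
  "x \<in> euclidean_topology K closure_of S \<longleftrightarrow>
     x \<in> carrier_vec K \<and>
     (\<forall>r>0. \<exists>y\<in>S \<inter> carrier_vec K. L2_set (\<lambda>i. x $ i - y $ i) {..<K} < r)"
proof -
  interpret Metric_space "carrier_vec K"
      "\<lambda>x y. L2_set (\<lambda>i. vec_index x i - vec_index y i) {..<K}"
    by (rule Metric_space_carrier_vec)
  show ?thesis
    by (auto simp: euclidean_topology_def metric_closure_of in_mball)
qed

lemma ordinal_cone_iff: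
  "y \<in> ordinal_cone K \<longleftrightarrow>
     y \<in> carrier_vec K \<and> (\<forall>j<K. 0 \<le> (\<Sum>i=j..<K. y $ i)) \<and> y \<noteq> 0\<^sub>v K"
proof
  assume "y \<in> ordinal_cone K"
  then obtain u v where y: "y = v - u" and u: "u \<in> carrier_vec K" and v: "v \<in> carrier_vec K"
    and le: "\<forall>j<K. (\<Sum>i=j..<K. u $ i) \<le> (\<Sum>i=j..<K. v $ i)" and ne: "u \<noteq> v"
    by (auto simp: ordinal_cone_def tail_dominates_def)
  have "(\<Sum>i=j..<K. y $ i) = (\<Sum>i=j..<K. v $ i) - (\<Sum>i=j..<K. u $ i)" for j
    using u by (simp add: y sum_subtractf)
  moreover have "y \<noteq> 0\<^sub>v K"
  proof
    assume 0: "y = 0\<^sub>v K"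
    have "u $ i = v $ i" if "i < K" for i
      using arg_cong[OF 0, of "\<lambda>w. w $ i"] that u by (simp add: y)
    then show False
      using ne u v by auto
  qed
  ultimately show "y \<in> carrier_vec K \<and> (\<forall>j<K. 0 \<le> (\<Sum>i=j..<K. y $ i)) \<and> y \<noteq> 0\<^sub>v K"
    using le u v by (simp add: y)
next
  assume "y \<in> carrier_vec K \<and> (\<forall>j<K. 0 \<le> (\<Sum>i=j..<K. y $ i)) \<and> y \<noteq> 0\<^sub>v K"
  then have "tail_dominates K (0\<^sub>v K) y" "y = y - 0\<^sub>v K" "y \<in> carrier_vec K"
      "0\<^sub>v K \<in> carrier_vec K"
    by (auto simp: tail_dominates_def)
  then show "y \<in> ordinal_cone K"
    unfolding ordinal_cone_def by blast
qed

lemma ordinal_cone_Un_zero_iff: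
  "y \<in> ordinal_cone K \<union> {0\<^sub>v K} \<longleftrightarrow>
     y \<in> carrier_vec K \<and> (\<forall>j<K. 0 \<le> (\<Sum>i=j..<K. y $ i))"
  by (auto simp: ordinal_cone_iff)

lemma upper_triangular_ones_mult_vec:
  fixes y :: "real vec"
  assumes "y \<in> carrier_vec K" "i < K"
  shows "(Matrix.mat K K (\<lambda>(i, j). if i \<le> j then 1 else 0) *\<^sub>v y) $ i = (\<Sum>j=i..<K. y $ j)"
proof -
  have "(Matrix.mat K K (\<lambda>(i, j). if i \<le> j then 1 else 0) *\<^sub>v y) $ i
      = (\<Sum>j=0..<K. if i \<le> j then y $ j else 0)"
    using assms by (auto simp: scalar_prod_def intro!: sum.cong)
  also have "\<dots> = (\<Sum>j\<in>{j\<in>{0..<K}. i \<le> j}. y $ j)"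
    by (rule sum.inter_filter[symmetric]) simp
  also have "{j\<in>{0..<K}. i \<le> j} = {i..<K}"
    by auto
  finally show ?thesis .
qed

lemma hcone_upper_triangular_ones_eq:
  "hcone (Matrix.mat K K (\<lambda>(i, j). if i \<le> j then 1 else 0)) = ordinal_cone K \<union> {0\<^sub>v K}"
proof (rule Set.set_eqI)
  fix y :: "real vec"
  show "y \<in> hcone (Matrix.mat K K (\<lambda>(i, j). if i \<le> j then 1 else 0))
      \<longleftrightarrow> y \<in> ordinal_cone K \<union> {0\<^sub>v K}"
    unfolding ordinal_cone_Un_zero_iff
    by (auto simp: hcone_def less_eq_vec_def upper_triangular_ones_mult_vec
        simp del: index_mult_mat_vec)
qed

lemma is_cone_ordinal_cone_Un_zero: "is_cone K (ordinal_cone K \<union> {0\<^sub>v K})"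
  unfolding is_cone_def
proof (intro conjI ballI allI impI subsetI)
  fix u :: "real vec" and c :: real
  assume "u \<in> ordinal_cone K \<union> {0\<^sub>v K}" and c: "0 < c"
  then have u: "u \<in> carrier_vec K" "\<And>j. j < K \<Longrightarrow> 0 \<le> (\<Sum>i=j..<K. u $ i)"
    unfolding ordinal_cone_Un_zero_iff by auto
  have "(\<Sum>i=j..<K. (c \<cdot>\<^sub>v u) $ i) = c * (\<Sum>i=j..<K. u $ i)" for j
    using u(1) by (simp add: sum_distrib_left)
  then show "c \<cdot>\<^sub>v u \<in> ordinal_cone K \<union> {0\<^sub>v K}"
    unfolding ordinal_cone_Un_zero_iff using u c by simp
qed (auto simp: ordinal_cone_iff)

lemma polyhedral_cone_ordinal_cone_Un_zero:
  assumes "K \<ge> 1"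
  shows "polyhedral_cone K (ordinal_cone K \<union> {0\<^sub>v K})"
proof -
  let ?A = "Matrix.mat K K (\<lambda>(i, j). if i \<le> j then 1 else 0) :: real mat"
  have "?A $$ (0, 0) \<noteq> 0\<^sub>m K K $$ (0, 0)"
    using assms by simp
  then have "?A \<noteq> 0\<^sub>m K K"
    by metis
  moreover have "?A \<in> carrier_mat K K"
    by simp
  ultimately show ?thesis
    unfolding polyhedral_cone_def
    using is_cone_ordinal_cone_Un_zero hcone_upper_triangular_ones_eq[symmetric] by blast
qed

text \<open>Each of the at most \<open>K\<close> coordinates in a tail differs by at most the distance, so tail
  sums are Lipschitz with constant \<open>K\<close>.\<close>

lemma tail_sum_diff_le:
  "(\<Sum>i=j..<K. y $ i) - (\<Sum>i=j..<K. x $ i) \<le> K * L2_set (\<lambda>i. x $ i - y $ i) {..<K}"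
proof -
  let ?d = "L2_set (\<lambda>i. x $ i - y $ i) {..<K}"
  have coord: "y $ i - x $ i \<le> ?d" if "i < K" for i
  proof -
    have "\<bar>x $ i - y $ i\<bar> = L2_set (\<lambda>i. x $ i - y $ i) {i}"
      by simp
    also have "\<dots> \<le> ?d"
      unfolding L2_set_def using that by (intro real_sqrt_le_mono sum_mono2) auto
    finally show ?thesis by linarith
  qed
  have "(\<Sum>i=j..<K. y $ i) - (\<Sum>i=j..<K. x $ i) = (\<Sum>i=j..<K. y $ i - x $ i)"
    by (simp add: sum_subtractf)
  also have "\<dots> \<le> (\<Sum>i=j..<K. ?d)"
    by (intro sum_mono coord) simp
  also have "\<dots> = real (K - j) * ?d"
    by simp
  also have "\<dots> \<le> real K * ?d"
    by (intro mult_right_mono) (simp_all add: L2_set_nonneg)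
  finally show ?thesis .
qed

lemma closure_of_ordinal_cone_subset:
  "euclidean_topology K closure_of ordinal_cone K \<subseteq> ordinal_cone K \<union> {0\<^sub>v K}"
proof
  fix x assume x: "x \<in> euclidean_topology K closure_of ordinal_cone K"
  have "0 \<le> (\<Sum>i=j..<K. x $ i)" if j: "j < K" for j
  proof (rule field_le_epsilon)
    fix e :: real assume "0 < e"
    then have "0 < e / K"
      using j by simp
    then obtain y where y: "y \<in> ordinal_cone K"
      and d: "L2_set (\<lambda>i. x $ i - y $ i) {..<K} < e / K"
      using x unfolding in_closure_of_euclidean_iff by blast
    have "0 \<le> (\<Sum>i=j..<K. y $ i)"
      using y j by (simp add: ordinal_cone_iff)
    moreover have "K * L2_set (\<lambda>i. x $ i - y $ i) {..<K} \<le> e"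
      using d j by (simp add: field_simps)
    ultimately show "0 \<le> (\<Sum>i=j..<K. x $ i) + e"
      using tail_sum_diff_le[where j=j and K=K and x=x and y=y] by linarith
  qed
  then show "x \<in> ordinal_cone K \<union> {0\<^sub>v K}"
    unfolding ordinal_cone_Un_zero_iff using x by (simp add: in_closure_of_euclidean_iff)
qed

lemma zero_in_closure_of_ordinal_cone:
  assumes "K \<ge> 1"
  shows "0\<^sub>v K \<in> euclidean_topology K closure_of ordinal_cone K"
  unfolding in_closure_of_euclidean_iff
proof (intro conjI allI impI)
  fix r :: real assume r: "r > 0"
  let ?y = "Matrix.vec K (\<lambda>i. if i = 0 then r / 2 else 0)"
  have "?y $ 0 \<noteq> 0\<^sub>v K $ 0"
    using assms r by simp
  then have "?y \<noteq> 0\<^sub>v K"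
    by metis
  moreover have "0 \<le> (\<Sum>i=j..<K. ?y $ i)" for j
    using r by (intro sum_nonneg) auto
  ultimately have "?y \<in> ordinal_cone K"
    using r by (simp add: ordinal_cone_iff)
  moreover have "L2_set (\<lambda>i. 0\<^sub>v K $ i - ?y $ i) {..<K} < r"
  proof -
    have "L2_set (\<lambda>i. 0\<^sub>v K $ i - ?y $ i) {..<K} \<le> (\<Sum>i<K. \<bar>0\<^sub>v K $ i - ?y $ i\<bar>)"
      by (rule L2_set_le_sum_abs)
    also have "\<dots> = (\<Sum>i<K. if i = 0 then r / 2 else 0)"
      using r by (intro sum.cong) auto
    also have "\<dots> < r"
      using assms r by simp
    finally show ?thesis .
  qed
  ultimately show "\<exists>y\<in>ordinal_cone K \<inter> carrier_vec K.
      L2_set (\<lambda>i. 0\<^sub>v K $ i - y $ i) {..<K} < r"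
    by (intro bexI[of _ ?y]) auto
qed simp

lemma ordinal_cone_subset_closure_of:
  "ordinal_cone K \<subseteq> euclidean_topology K closure_of ordinal_cone K"
proof
  fix x assume x: "x \<in> ordinal_cone K"
  then have "x \<in> carrier_vec K"
    by (simp add: ordinal_cone_iff)
  moreover have "L2_set (\<lambda>i. x $ i - x $ i) {..<K} = 0"
    by (simp add: L2_set_def)
  ultimately show "x \<in> euclidean_topology K closure_of ordinal_cone K"
    unfolding in_closure_of_euclidean_iff using x by force
qed

theorem theorem17:
  fixes K :: nat
  assumes "K \<ge> 1"
  shows "euclidean_topology K closure_of ordinal_cone K = ordinal_cone K \<union> {0\<^sub>v K}
    \<and> polyhedral_cone K (ordinal_cone K \<union> {0\<^sub>v K})
    \<and> ordinal_cone K \<union> {0\<^sub>v K} = hcone (Matrix.mat K K (\<lambda>(i, j). if i \<le> j then 1 else 0))"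
  using closure_of_ordinal_cone_subset ordinal_cone_subset_closure_of
    zero_in_closure_of_ordinal_cone[OF assms] polyhedral_cone_ordinal_cone_Un_zero[OF assms]
    hcone_upper_triangular_ones_eq
  by blast

end
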